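(* Let $X$ be a subshift such that for every $x\in X$ we have $d(\{i\in\mathbb{N}: x_i=0\})=1$. Then there exists a mixing subshift $Y$ containing $X$ such that there is no DC3 pair in $Y$ (for the shift map).
   Context: $\mathbb{N}=\{1,2,3,\dots\}$. For $n\ge1$, $\Sigma_n^+$ denotes $\{0,\dots,n-1\}^{\mathbb{N}}$ with the product of discrete topologies and the shift map $(\sigma(x))_i=x_{i+1}$. A subshift (also called a shift or shift space) is a nonempty, closed, $\sigma$-invariant ($\sigma(S)\subseteq S$) subset $S$ of some $\Sigma_n^+$, considered with the restriction of $\sigma$. The metric is $\rho(x,y)=2^{-k}$ for $x\ne y$, where $k$ is the length of the maximal common prefix of $x$ and $y$, and $\rho(x,x)=0$. Density: for $A\subseteq\mathbb{N}$, $d(A)=\lim_{n\to\infty}\frac{|A\cap\{1,\dots,n\}|}{n}$ (when the limit exists). Mixing: a dynamical system $(X,f)$ is mixing if for all nonempty open $U,V\subseteq X$ we have $f^n(U)\cap V\neq\emptyset$ for all sufficiently large $n$. A subshift $Y$ is mixing if $(Y,\sigma)$ is mixing. DC3 pairs: for a dynamical system $(X,f)$ with metric $\rho$, $x,y\in X$, $n\ge 1$ and $t\in(0,\operatorname{diam}X]$ let $F^{(n)}_{xy}(t)=\frac1n|\{0\le i<n:\rho(f^i(x),f^i(y))<t\}|$, $F_{xy}(t)=\liminf_{n\to\infty}F^{(n)}_{xy}(t)$, $F^*_{xy}(t)=\limsup_{n\to\infty}F^{(n)}_{xy}(t)$, extended by $F_{xy}(t)=F^*_{xy}(t)=0$ for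 $t\le0$ and $F_{xy}(t)=F^*_{xy}(t)=1$ for $t>\operatorname{diam}X$. The pair $(x,y)$ is a DC3 pair if there are $a<b$ such that $F^*_{xy}(t)>F_{xy}(t)$ for every $t\in(a,b)$. *)

theory Defs
  imports "HOL-Analysis.Analysis"
begin

text \<open>
  Sequences over an alphabet \<open>{0, \<dots>, n - 1}\<close> are functions of type \<open>nat \<Rightarrow> nat\<close>. Positions are
  counted from 0 here and from 1 in the mathematical text: the symbol \<open>x\<^sub>i\<close> (\<open>i \<ge> 1\<close>) is \<open>x (i - 1)\<close>.
  The library topology on \<open>nat\<close> is discrete and the one on \<open>nat \<Rightarrow> nat\<close> is the product topology.
\<close>

definition full_shift :: "nat \<Rightarrow> (nat \<Rightarrow> nat) set" where
  "full_shift n = {x. \<forall>i. x i \<in> {0..<n}}"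

definition shift_map :: "(nat \<Rightarrow> nat) \<Rightarrow> (nat \<Rightarrow> nat)" where
  "shift_map x = (\<lambda>i. x (Suc i))"

definition subshift :: "(nat \<Rightarrow> nat) set \<Rightarrow> bool" where
  "subshift S \<longleftrightarrow>
     (\<exists>n\<ge>1. S \<noteq> {} \<and> closedin (top_of_set (full_shift n)) S \<and> shift_map ` S \<subseteq> S)"

definition common_prefix_length :: "(nat \<Rightarrow> nat) \<Rightarrow> (nat \<Rightarrow> nat) \<Rightarrow> nat" where
  \<comment> \<open>only meaningful for \<open>x \<noteq> y\<close>\<close>
  "common_prefix_length x y = (GREATEST k. \<forall>i<k. x i = y i)"

definition shift_dist :: "(nat \<Rightarrow> nat) \<Rightarrow> (nat \<Rightarrow> nat) \<Rightarrow> real" where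
  "shift_dist x y = (if x = y then 0 else (1 / 2) ^ common_prefix_length x y)"

definition has_density :: "nat set \<Rightarrow> real \<Rightarrow> bool" where
  "has_density A \<delta> \<longleftrightarrow> (\<lambda>n. real (card (A \<inter> {1..n})) / real n) \<longlonglongrightarrow> \<delta>"

definition mixing :: "'a::topological_space set \<Rightarrow> ('a \<Rightarrow> 'a) \<Rightarrow> bool" where
  "mixing X f \<longleftrightarrow>
     (\<forall>U V. openin (top_of_set X) U \<and> U \<noteq> {} \<and> openin (top_of_set X) V \<and> V \<noteq> {} \<longrightarrow>
        (\<exists>N. \<forall>n\<ge>N. (f ^^ n) ` U \<inter> V \<noteq> {}))"

text \<open>
  Distributional chaos for a map \<open>f\<close> on a set \<open>X\<close> with an explicitly given (bounded) metric \<open>\<rho>\<close>.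
  The limits inferior and superior are taken in the extended reals, which are a complete lattice.
\<close>

definition diam :: "'a set \<Rightarrow> ('a \<Rightarrow> 'a \<Rightarrow> real) \<Rightarrow> real" where
  "diam X \<rho> = (SUP (x, y)\<in>X \<times> X. \<rho> x y)"

definition dist_freq ::
  "('a \<Rightarrow> 'a \<Rightarrow> real) \<Rightarrow> ('a \<Rightarrow> 'a) \<Rightarrow> 'a \<Rightarrow> 'a \<Rightarrow> nat \<Rightarrow> real \<Rightarrow> real" where
  "dist_freq \<rho> f x y n t = real (card {i. i < n \<and> \<rho> ((f ^^ i) x) ((f ^^ i) y) < t}) / real n"

definition lower_dist ::
  "'a set \<Rightarrow> ('a \<Rightarrow> 'a \<Rightarrow> real) \<Rightarrow> ('a \<Rightarrow> 'a) \<Rightarrow> 'a \<Rightarrow> 'a \<Rightarrow> real \<Rightarrow> ereal" where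
  "lower_dist X \<rho> f x y t =
     (if t \<le> 0 then 0 else if t > diam X \<rho> then 1
      else liminf (\<lambda>n. ereal (dist_freq \<rho> f x y n t)))"

definition upper_dist ::
  "'a set \<Rightarrow> ('a \<Rightarrow> 'a \<Rightarrow> real) \<Rightarrow> ('a \<Rightarrow> 'a) \<Rightarrow> 'a \<Rightarrow> 'a \<Rightarrow> real \<Rightarrow> ereal" where
  "upper_dist X \<rho> f x y t =
     (if t \<le> 0 then 0 else if t > diam X \<rho> then 1
      else limsup (\<lambda>n. ereal (dist_freq \<rho> f x y n t)))"

definition DC3_pair ::
  "'a set \<Rightarrow> ('a \<Rightarrow> 'a \<Rightarrow> real) \<Rightarrow> ('a \<Rightarrow> 'a) \<Rightarrow> 'a \<Rightarrow> 'a \<Rightarrow> bool" where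
  "DC3_pair X \<rho> f x y \<longleftrightarrow>
     x \<in> X \<and> y \<in> X \<and>
     (\<exists>a b. a < b \<and> (\<forall>t\<in>{a<..<b}. upper_dist X \<rho> f x y t > lower_dist X \<rho> f x y t))"

end

(*
  Let f l be the largest number of nonzero symbols in a word of length l of X. A greedy decomposition
  into blocks with few nonzero symbols, of length bounded by compactness of X, shows f l / l -> 0.
  Put g l = f l + sqrt l and let Y consist of all sequences over the alphabet whose windows of
  length l have at most g l nonzero symbols. Words of Y can be glued along a long block of zeros
  because g is nondecreasing and unbounded, so Y is mixing. Because g l / l -> 0, the zeros of every
  point of Y have density 1, so any two orbits in Y are close along a set of times of density 1
  and both distribution functions of the pair are 1 on the positive reals.
*)
theory Submission
  imports Defs "HOL-Real_Asymp.Real_Asymp"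
begin

section \<open>Nonzero symbols in windows\<close>

definition weight :: "(nat \<Rightarrow> nat) \<Rightarrow> nat \<Rightarrow> nat \<Rightarrow> nat" where
  "weight x i l = card {j \<in> {i..<i + l}. x j \<noteq> 0}"

lemma shift_map_funpow: "(shift_map ^^ n) x = (\<lambda>i. x (n + i))"
  by (induction n arbitrary: x) (auto simp: shift_map_def)

lemma weight_le: "weight x i l \<le> l"
  unfolding weight_def by (rule order_trans[OF card_mono[of "{i..<i + l}"]]) auto

lemma weight_mono: "l \<le> m \<Longrightarrow> weight x i l \<le> weight x i m"
  unfolding weight_def by (rule card_mono) auto

lemma weight_translate: "weight (\<lambda>j. x (a + j)) i l = weight x (a + i) l"
  unfolding weight_def
  by (rule bij_betw_same_card[of "\<lambda>j. a + j"], rule bij_betwI[of _ _ _ "\<lambda>j. j - a"]) auto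

lemma weight_funpow: "weight ((shift_map ^^ a) x) i l = weight x (a + i) l"
  unfolding shift_map_funpow by (rule weight_translate)

lemma weight_append: "weight x i (l + m) = weight x i l + weight x (i + l) m"
proof -
  have "{j \<in> {i..<i + (l + m)}. x j \<noteq> 0} =
      {j \<in> {i..<i + l}. x j \<noteq> 0} \<union> {j \<in> {i + l..<i + l + m}. x j \<noteq> 0}"
    by auto
  then show ?thesis
    unfolding weight_def by (simp add: card_Un_disjoint disjoint_iff)
qed

text \<open>The weight of a window is a finite sum of indicators of single coordinates, and every
  function on a discrete space is continuous. This makes the sets compared with a constant below
  closed or open.\<close>

lemma continuous_on_weight: "continuous_on UNIV (\<lambda>x. weight x i l)"
proof -
  have "weight x i l = (\<Sum>j\<in>{i..<i + l}. of_bool (x j \<noteq> 0))" for x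
    unfolding weight_def by (simp add: Int_def)
  moreover have "continuous_on UNIV (\<lambda>x::nat \<Rightarrow> nat. of_bool (x j \<noteq> 0) :: nat)" for j
    by (rule continuous_on_compose2[OF Topological_Spaces.continuous_on_discrete[of UNIV "\<lambda>a. of_bool (a \<noteq> 0)"]
          continuous_on_product_coordinates]) auto
  ultimately show ?thesis
    by (simp only: continuous_on_sum)
qed

lemma closed_weight_le: "closed {x. real (weight x i l) \<le> c}"
  by (intro closed_Collect_le continuous_on_of_nat continuous_on_weight continuous_on_const)

lemma open_weight_less: "open {x. real (weight x i l) < c}"
  by (intro open_Collect_less continuous_on_of_nat continuous_on_weight continuous_on_const)

text \<open>Zeros and nonzero symbols partition the first \<open>n\<close> positions, so their
  frequencies add up to 1. The bijection \<open>j - 1\<close> passes from positions counted from 1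
  to positions counted from 0.\<close>

lemma weight_density:
  assumes "has_density {i. i \<ge> 1 \<and> x (i - 1) = 0} 1"
  shows "(\<lambda>n. real (weight x 0 n) / real n) \<longlonglongrightarrow> 0"
proof -
  let ?A = "{i. i \<ge> 1 \<and> x (i - 1) = 0}"
  have card: "card (?A \<inter> {1..n}) + weight x 0 n = n" for n
  proof -
    have "card (?A \<inter> {1..n}) = card {j \<in> {0..<n}. x j = 0}"
      by (rule bij_betw_same_card[of "\<lambda>j. j - 1"], rule bij_betwI[of _ _ _ Suc]) auto
    moreover have "card {j \<in> {0..<n}. x j = 0} + card {j \<in> {0..<n}. x j \<noteq> 0} =
        card ({j \<in> {0..<n}. x j = 0} \<union> {j \<in> {0..<n}. x j \<noteq> 0})"
      by (rule card_Un_disjoint[symmetric]) auto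
    moreover have "{j \<in> {0..<n}. x j = 0} \<union> {j \<in> {0..<n}. x j \<noteq> 0} = {0..<n}"
      by auto
    ultimately show ?thesis
      by (simp add: weight_def)
  qed
  have "(\<lambda>n. 1 - real (card (?A \<inter> {1..n})) / real n) \<longlonglongrightarrow> 1 - 1"
    using assms unfolding has_density_def by (intro tendsto_diff tendsto_const)
  \<comment> \<open>The equality fails at \<open>n = 0\<close>: division by 0 gives 0, so the left
    side is 1 and the right side 0.\<close>
  moreover have "\<forall>\<^sub>F n in sequentially.
      1 - real (card (?A \<inter> {1..n})) / real n = real (weight x 0 n) / real n"
  proof (rule eventually_sequentiallyI)
    fix n :: nat assume "1 \<le> n"
    moreover have "real (card (?A \<inter> {1..n})) + real (weight x 0 n) = real n"
      using card[of n] by linarith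
    ultimately show "1 - real (card (?A \<inter> {1..n})) / real n = real (weight x 0 n) / real n"
      by (simp add: field_simps)
  qed
  ultimately show ?thesis
    by (simp add: tendsto_cong)
qed

section \<open>Uniformly sparse subshifts\<close>

lemma compact_full_shift: "compact (full_shift n)"
proof -
  have "compactin (product_topology (\<lambda>i. euclidean) UNIV) (Pi\<^sub>E UNIV (\<lambda>i::nat. {0..<n}))"
    unfolding compactin_PiE by (simp add: finite_imp_compact)
  moreover have "Pi\<^sub>E UNIV (\<lambda>i::nat. {0..<n}) = full_shift n"
    by (auto simp: full_shift_def)
  ultimately show ?thesis
    by (simp add: euclidean_product_topology)
qed

text \<open>Prefixes are enough for a shift-invariant set: a window of \<open>x\<close> at
  \<open>i\<close> is a prefix of the \<open>i\<close>-th shift of \<open>x\<close>.\<close>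

definition max_weight :: "(nat \<Rightarrow> nat) set \<Rightarrow> nat \<Rightarrow> nat" where
  "max_weight X l = (SUP x\<in>X. weight x 0 l)"

lemma weight_le_max_weight: "x \<in> X \<Longrightarrow> weight x 0 l \<le> max_weight X l"
  unfolding max_weight_def
  by (rule cSUP_upper) (auto intro!: bdd_aboveI[of _ l] weight_le)

lemma max_weight_mono:
  assumes "X \<noteq> {}" "l \<le> m"
  shows "max_weight X l \<le> max_weight X m"
  unfolding max_weight_def[of X l]
  by (rule cSUP_least) (use assms weight_mono weight_le_max_weight order_trans in blast)+

text \<open>Compactness makes the pointwise limits uniform: finitely many lengths suffice for every
  point to have a prefix with a share of nonzero symbols below \<epsilon>. Cutting off such prefixes
  repeatedly leaves a remainder of length at most \<open>M\<close>, whose weight is bounded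
  trivially.\<close>

lemma max_weight_sublinear:
  assumes "compact X" "X \<noteq> {}" and inv: "shift_map ` X \<subseteq> X"
    and lim: "\<And>x. x \<in> X \<Longrightarrow> (\<lambda>n. real (weight x 0 n) / real n) \<longlonglongrightarrow> 0"
  shows "(\<lambda>n. real (max_weight X n) / real n) \<longlonglongrightarrow> 0"
proof (rule LIMSEQ_I)
  fix e :: real assume "e > 0"
  \<comment> \<open>One half of \<open>e\<close> pays for the sparse blocks, the other for the
    constant \<open>M\<close> left by the remainder.\<close>
  define \<epsilon> where "\<epsilon> = e / 2"
  have "\<epsilon> > 0"
    using \<open>e > 0\<close> by (simp add: \<epsilon>_def)
  define S where "S n = {x. real (weight x 0 n) < \<epsilon> * real n}" for n
  \<comment> \<open>Lengths start at 1 so that each cut strictly shortens the word and the induction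
    below descends.\<close>
  have "X \<subseteq> (\<Union>n\<in>{1..}. S n)"
  proof
    fix x assume "x \<in> X"
    have "\<forall>\<^sub>F n in sequentially. real (weight x 0 n) / real n < \<epsilon> \<and> n \<ge> 1"
      using order_tendstoD(2)[OF lim[OF \<open>x \<in> X\<close>] \<open>\<epsilon> > 0\<close>] eventually_ge_at_top[of 1]
      by eventually_elim simp
    then obtain n where "real (weight x 0 n) / real n < \<epsilon>" "n \<ge> 1"
      by (auto dest: eventually_happens)
    then have "x \<in> S n"
      by (simp add: S_def field_simps)
    then show "x \<in> (\<Union>n\<in>{1..}. S n)"
      using \<open>n \<ge> 1\<close> by auto
  qed
  moreover have "open (S n)" for n
    unfolding S_def by (rule open_weight_less)
  ultimately obtain C where C: "C \<subseteq> {1..}" "finite C" "X \<subseteq> (\<Union>n\<in>C. S n)"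
    using \<open>compact X\<close> by (meson compactE_image)
  define M where "M = Max C"
  have bound: "real (weight x 0 n) \<le> \<epsilon> * real n + real M" if "x \<in> X" for x n
    using that
  proof (induction n arbitrary: x rule: less_induct)
    case (less n)
    from less.prems C obtain m where m: "m \<in> C" "x \<in> S m"
      by blast
    have "m \<ge> 1" "m \<le> M"
      using m(1) C by (auto simp: M_def)
    show ?case
    proof (cases "n \<le> m")
      case True
      then have "real (weight x 0 n) \<le> real M"
        using weight_le[of x 0 n] \<open>m \<le> M\<close> by linarith
      then show ?thesis
        using \<open>\<epsilon> > 0\<close> by (simp add: add_increasing)
    next
      case False
      have "(shift_map ^^ m) x \<in> X"
        using less.prems inv by (induction m) auto
      then have "real (weight x m (n - m)) \<le> \<epsilon> * real (n - m) + real M"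
        using less.IH[of "n - m" "(shift_map ^^ m) x"] False \<open>m \<ge> 1\<close> by (simp add: weight_funpow)
      moreover have "real (weight x 0 m) < \<epsilon> * real m"
        using m(2) by (simp add: S_def)
      moreover have "weight x 0 n = weight x 0 m + weight x m (n - m)"
        using weight_append[of x 0 m "n - m"] False by simp
      moreover have "\<epsilon> * real n = \<epsilon> * real m + \<epsilon> * real (n - m)"
        using False by (simp flip: distrib_left of_nat_add)
      ultimately show ?thesis
        by simp
    qed
  qed
  have max_bound: "real (max_weight X n) \<le> \<epsilon> * real n + real M" for n
  proof -
    \<comment> \<open>A nonempty bounded set of naturals attains its supremum, so the bound for
      single points carries over.\<close>
    have "max_weight X n \<in> (\<lambda>x. weight x 0 n) ` X"
      unfolding max_weight_def using \<open>X \<noteq> {}\<close> finite_subset[of _ "{..n}"]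
      by (subst cSup_eq_Max) (auto intro!: Max_in simp: weight_le image_subset_iff)
    then show ?thesis
      using bound by auto
  qed
  obtain K where K: "real M < \<epsilon> * real K"
    using reals_Archimedean3[OF \<open>\<epsilon> > 0\<close>] by (metis mult.commute)
  show "\<exists>n0. \<forall>n\<ge>n0. norm (real (max_weight X n) / real n - 0) < e"
  proof (intro exI allI impI)
    fix n assume n: "Suc K \<le> n"
    have "\<epsilon> * real K \<le> \<epsilon> * real n"
      using n \<open>\<epsilon> > 0\<close> by (intro mult_left_mono) auto
    then have "real (max_weight X n) < e * real n"
      using max_bound[of n] K by (simp add: \<epsilon>_def)
    then show "norm (real (max_weight X n) / real n - 0) < e"
      using n by (simp add: divide_less_eq)
  qed
qed

section \<open>The shift of sequences with prescribed sparseness\<close>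

text \<open>Bounding windows at all positions, not only prefixes, makes the set shift invariant; as
  an intersection of closed conditions on windows it is closed.\<close>

definition sparse_shift :: "nat \<Rightarrow> (nat \<Rightarrow> real) \<Rightarrow> (nat \<Rightarrow> nat) set" where
  "sparse_shift N g = {y \<in> full_shift N. \<forall>i l. real (weight y i l) \<le> g l}"

lemma sparse_shift_weight: "y \<in> sparse_shift N g \<Longrightarrow> real (weight y i l) \<le> g l"
  by (simp add: sparse_shift_def)

lemma sparse_shift_funpow:
  "y \<in> sparse_shift N g \<Longrightarrow> (shift_map ^^ n) y \<in> sparse_shift N g"
  unfolding sparse_shift_def by (auto simp: weight_funpow) (simp add: shift_map_funpow full_shift_def)

lemma subshift_sparse_shift:
  assumes "N \<ge> 1" "\<And>l. g l \<ge> 0"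
  shows "subshift (sparse_shift N g)"
proof -
  have "weight (\<lambda>_. 0) i l = 0" for i l
    by (simp add: weight_def)
  then have "(\<lambda>_. 0) \<in> sparse_shift N g"
    using assms by (simp add: sparse_shift_def full_shift_def)
  moreover have "closedin (top_of_set (full_shift N)) (sparse_shift N g)"
  proof -
    have "closed (\<Inter>i. \<Inter>l. {y. real (weight y i l) \<le> g l})"
      by (intro closed_INT ballI closed_weight_le)
    moreover have "sparse_shift N g = full_shift N \<inter> (\<Inter>i. \<Inter>l. {y. real (weight y i l) \<le> g l})"
      by (auto simp: sparse_shift_def)
    ultimately show ?thesis
      by (simp add: closedin_closed_Int)
  qed
  moreover have "shift_map ` sparse_shift N g \<subseteq> sparse_shift N g"
    using sparse_shift_funpow[of _ N g 1] by auto
  ultimately show ?thesis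
    unfolding subshift_def using \<open>N \<ge> 1\<close> by blast
qed

section \<open>Gluing words of the sparse shift, and mixing\<close>

lemma openin_contains_cylinder:
  assumes "openin (top_of_set Y) U" "y \<in> U"
  obtains k :: nat where "\<And>z. z \<in> Y \<Longrightarrow> (\<And>i. i < k \<Longrightarrow> z i = (y i :: nat)) \<Longrightarrow> z \<in> U"
proof -
  obtain T where T: "open T" "U = Y \<inter> T"
    using assms(1) by (auto simp: openin_open)
  then have "openin (product_topology (\<lambda>i. euclidean) UNIV) T" "y \<in> T"
    using assms(2) by (auto simp: open_fun_def)
  then obtain B where B: "y \<in> Pi\<^sub>E UNIV B" "finite {i. B i \<noteq> UNIV}" "Pi\<^sub>E UNIV B \<subseteq> T"
    using product_topology_open_contains_basis[of "\<lambda>i. euclidean" UNIV T y] by auto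
  \<comment> \<open>A basic open set of the product topology restricts finitely many coordinates, so
    agreement on a long enough prefix keeps a point inside it.\<close>
  obtain k where k: "\<And>i. B i \<noteq> UNIV \<Longrightarrow> i < k"
    using B(2) unfolding finite_nat_set_iff_bounded by auto
  show ?thesis
  proof
    fix z assume z: "z \<in> Y" "\<And>i. i < k \<Longrightarrow> z i = y i"
    have "z i \<in> B i" for i
    proof (cases "B i = UNIV")
      case False
      then show ?thesis
        using k z(2) B(1) by (metis PiE_E UNIV_I)
    qed simp
    then have "z \<in> Pi\<^sub>E UNIV B"
      by auto
    then show "z \<in> U"
      using T z(1) B(3) by auto
  qed
qed

text \<open>For \<open>n \<ge> k\<close> this point starts like \<open>y\<close> and its
  \<open>n\<close>-th shift starts like \<open>z\<close>, as a witness of mixing must. Zeros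
  elsewhere add no weight.\<close>

definition glue :: "nat \<Rightarrow> nat \<Rightarrow> (nat \<Rightarrow> nat) \<Rightarrow> (nat \<Rightarrow> nat) \<Rightarrow> nat \<Rightarrow> nat" where
  "glue k n y z i = (if i < k then y i else if n \<le> i \<and> i < n + k then z (i - n) else 0)"

lemma weight_glue_head:
  assumes "i + l \<le> n"
  shows "weight (glue k n y z) i l \<le> weight y i l"
  unfolding weight_def using assms by (intro card_mono) (auto simp: glue_def)

text \<open>A window starting in the gap sees only zeros before position \<open>n\<close>.
  Translating its remaining part by \<open>n\<close> gives a prefix of \<open>z\<close> of length at
  most \<open>l\<close>.\<close>

lemma weight_glue_tail:
  assumes "k \<le> i" "i \<le> n"
  shows "weight (glue k n y z) i l \<le> weight z 0 l"
  unfolding weight_def using assms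
  by (intro card_inj_on_le[of "\<lambda>j. j - n"])
    (auto simp: glue_def inj_on_def split: if_splits)

lemma weight_glue_beyond:
  assumes "k \<le> n" "n \<le> i"
  shows "weight (glue k n y z) i l \<le> weight z (i - n) l"
  unfolding weight_def using assms
  by (intro card_inj_on_le[of "\<lambda>j. j - n"])
    (auto simp: glue_def inj_on_def split: if_splits)

lemma weight_glue_total: "weight (glue k n y z) i l \<le> weight y 0 k + weight z 0 k"
proof -
  have "weight (glue k n y z) i l \<le>
      card ({j \<in> {0..<k}. y j \<noteq> 0} \<union> (\<lambda>j. j + n) ` {j \<in> {0..<k}. z j \<noteq> 0})"
    unfolding weight_def
  proof (rule card_mono)
    show "{j \<in> {i..<i + l}. glue k n y z j \<noteq> 0} \<subseteq>
        {j \<in> {0..<k}. y j \<noteq> 0} \<union> (\<lambda>j. j + n) ` {j \<in> {0..<k}. z j \<noteq> 0}"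
    proof
      fix j assume j: "j \<in> {j \<in> {i..<i + l}. glue k n y z j \<noteq> 0}"
      show "j \<in> {j \<in> {0..<k}. y j \<noteq> 0} \<union> (\<lambda>j. j + n) ` {j \<in> {0..<k}. z j \<noteq> 0}"
      proof (cases "j < k")
        case False
        then have "j = (j - n) + n" "j - n \<in> {j \<in> {0..<k}. z j \<noteq> 0}"
          using j by (auto simp: glue_def split: if_splits)
        then show ?thesis
          by blast
      qed (use j in \<open>auto simp: glue_def\<close>)
    qed
  qed simp
  also have "\<dots> \<le> card {j \<in> {0..<k}. y j \<noteq> 0} + card {j \<in> {0..<k}. z j \<noteq> 0}"
    by (rule order_trans[OF card_Un_le]) (simp add: card_image_le)
  finally show ?thesis
    by (simp add: weight_def)
qed

text \<open>A window longer than the gap may meet both words, but carries at most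
  \<open>2 * g k\<close> nonzero symbols, which \<open>gap\<close> and monotonicity bound by
  \<open>g l\<close>. A shorter window meets at most one of the words and inherits the bound from
  \<open>y\<close> or \<open>z\<close>.\<close>

lemma glue_in_sparse_shift:
  assumes "N \<ge> 1" "mono g" and y: "y \<in> sparse_shift N g" and z: "z \<in> sparse_shift N g"
    and "k \<le> n" and gap: "2 * g k \<le> g (n - k)"
  shows "glue k n y z \<in> sparse_shift N g"
proof -
  have "real (weight (glue k n y z) i l) \<le> g l" for i l
  proof (cases "l \<le> n - k")
    case False
    have "real (weight (glue k n y z) i l) \<le> 2 * g k"
      using weight_glue_total[of k n y z i l]
        sparse_shift_weight[OF y, of 0 k] sparse_shift_weight[OF z, of 0 k] by linarith
    also have "\<dots> \<le> g l"
      using gap monoD[OF \<open>mono g\<close>, of "n - k" l] False by linarith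
    finally show ?thesis .
  next
    case True
    \<comment> \<open>If \<open>i < k\<close>, then \<open>l \<le> n - k\<close> forces the window
      to end before the second word begins.\<close>
    then consider "i + l \<le> n" | "k \<le> i" "i \<le> n" | "n \<le> i"
      by linarith
    then show ?thesis
    proof cases
      case 1
      then show ?thesis
        using weight_glue_head[of i l n k y z] sparse_shift_weight[OF y, of i l] by linarith
    next
      case 2
      then show ?thesis
        using weight_glue_tail[of k i n y z l] sparse_shift_weight[OF z, of 0 l] by linarith
    next
      case 3
      then show ?thesis
        using weight_glue_beyond[of k n i y z l] \<open>k \<le> n\<close>
          sparse_shift_weight[OF z, of "i - n" l] by linarith
    qed
  qed
  moreover have "glue k n y z \<in> full_shift N"
    using y z \<open>N \<ge> 1\<close> by (auto simp: sparse_shift_def full_shift_def glue_def)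
  ultimately show ?thesis
    by (simp add: sparse_shift_def)
qed

lemma mixing_sparse_shift:
  assumes "N \<ge> 1" "mono g" and lim: "filterlim g at_top sequentially"
  shows "mixing (sparse_shift N g) shift_map"
  unfolding mixing_def
proof (intro allI impI, elim conjE)
  let ?Y = "sparse_shift N g"
  fix U V
  assume U: "openin (top_of_set ?Y) U" "U \<noteq> {}" and V: "openin (top_of_set ?Y) V" "V \<noteq> {}"
  then obtain y z where y: "y \<in> U" and z: "z \<in> V"
    by auto
  have yY: "y \<in> ?Y" and zY: "z \<in> ?Y"
    using openin_subset[OF U(1)] openin_subset[OF V(1)] y z by auto
  obtain k1 where k1: "\<And>w. w \<in> ?Y \<Longrightarrow> (\<And>i. i < k1 \<Longrightarrow> w i = y i) \<Longrightarrow> w \<in> U"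
    using openin_contains_cylinder[OF U(1) y] by metis
  obtain k2 where k2: "\<And>w. w \<in> ?Y \<Longrightarrow> (\<And>i. i < k2 \<Longrightarrow> w i = z i) \<Longrightarrow> w \<in> V"
    using openin_contains_cylinder[OF V(1) z] by metis
  define k where "k = max k1 k2"
  obtain M where M: "\<And>m. m \<ge> M \<Longrightarrow> 2 * g k \<le> g m"
    using lim unfolding filterlim_at_top eventually_sequentially by meson
  show "\<exists>L. \<forall>n\<ge>L. (shift_map ^^ n) ` U \<inter> V \<noteq> {}"
  proof (intro exI allI impI)
    \<comment> \<open>The summand \<open>k\<close> keeps the words disjoint, and \<open>M\<close>
      makes the gap \<open>n - k\<close> long enough for \<open>g\<close> to reach
      \<open>2 * g k\<close>.\<close>
    fix n assume n: "n \<ge> k + M"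
    have w: "glue k n y z \<in> ?Y"
      using n by (intro glue_in_sparse_shift assms yY zY M) auto
    have "glue k n y z \<in> U"
      using w by (rule k1) (simp add: glue_def k_def less_max_iff_disj)
    moreover have "(shift_map ^^ n) (glue k n y z) \<in> V"
      using sparse_shift_funpow[OF w]
      by (rule k2) (use n in \<open>auto simp: shift_map_funpow glue_def k_def\<close>)
    ultimately show "(shift_map ^^ n) ` U \<inter> V \<noteq> {}"
      by blast
  qed
qed

section \<open>Absence of distributional chaos\<close>

lemma shift_dist_le:
  assumes "\<And>i. i < k \<Longrightarrow> x i = y i"
  shows "shift_dist x y \<le> (1 / 2) ^ k"
proof (cases "x = y")
  case False
  then obtain d where d: "x d \<noteq> y d"
    by auto
  \<comment> \<open>The disagreement at \<open>d\<close> bounds the lengths of common prefixes, so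
    \<open>GREATEST\<close> is well behaved.\<close>
  have "k \<le> common_prefix_length x y"
    unfolding common_prefix_length_def
    by (rule Greatest_le_nat[where b = d]) (use assms d in \<open>auto simp: not_less[symmetric]\<close>)
  then show ?thesis
    using False by (simp add: shift_dist_def power_decreasing)
qed (simp add: shift_dist_def)

text \<open>At time \<open>i\<close> the orbits are within \<open>t\<close> if both show
  \<open>k\<close> zeros. Otherwise one of them has a nonzero symbol at some offset
  \<open>j < k\<close>. Each offset accounts for at most \<open>g\<close> times per sequence, hence
  \<open>2 * k * g\<close> bad times in all.\<close>

lemma dist_freq_ge:
  assumes "(1 / 2) ^ k < t"
    and g: "\<And>i. real (weight x i n) \<le> g" "\<And>i. real (weight y i n) \<le> g"
    and "n > 0"
  shows "dist_freq shift_dist shift_map x y n t \<ge> 1 - 2 * real k * (g / real n)"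
proof -
  let ?near = "{i. i < n \<and> shift_dist ((shift_map ^^ i) x) ((shift_map ^^ i) y) < t}"
  define bad where "bad u = (\<Union>j<k. {i. i < n \<and> u (j + i) \<noteq> (0::nat)})" for u
  have card_bad: "real (card (bad u)) \<le> real k * g" if u: "\<And>i. real (weight u i n) \<le> g" for u
  proof -
    have "card {i. i < n \<and> u (j + i) \<noteq> 0} = weight u j n" for j
      using weight_translate[of u j 0 n] by (simp add: weight_def)
    then have "card (bad u) \<le> (\<Sum>j<k. weight u j n)"
      unfolding bad_def using card_UN_le[of "{..<k}" "\<lambda>j. {i. i < n \<and> u (j + i) \<noteq> 0}"] by simp
    then have "real (card (bad u)) \<le> (\<Sum>j<k. real (weight u j n))"
      by (simp flip: of_nat_sum)
    also have "\<dots> \<le> (\<Sum>j<k. g)"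
      by (intro sum_mono u)
    finally show ?thesis
      by simp
  qed
  have "{..<n} \<subseteq> ?near \<union> (bad x \<union> bad y)"
  proof
    fix i assume i: "i \<in> {..<n}"
    show "i \<in> ?near \<union> (bad x \<union> bad y)"
    proof (rule ccontr)
      assume far: "i \<notin> ?near \<union> (bad x \<union> bad y)"
      then have "x (j + i) = 0 \<and> y (j + i) = 0" if "j < k" for j
        using that i by (auto simp: bad_def)
      then have "shift_dist ((shift_map ^^ i) x) ((shift_map ^^ i) y) \<le> (1 / 2) ^ k"
        by (intro shift_dist_le) (simp add: shift_map_funpow add.commute)
      then show False
        using far i assms(1) by auto
    qed
  qed
  then have "card {..<n} \<le> card (?near \<union> (bad x \<union> bad y))"
    by (rule card_mono[rotated]) (auto simp: bad_def)
  also have "\<dots> \<le> card ?near + (card (bad x) + card (bad y))"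
    by (meson add_left_mono card_Un_le order_trans)
  finally have "real n \<le> real (card ?near) + 2 * real k * g"
    using card_bad[of x] card_bad[of y] g by fastforce
  then have "(real n - 2 * real k * g) / real n \<le> real (card ?near) / real n"
    by (intro divide_right_mono) auto
  then show ?thesis
    using \<open>n > 0\<close> by (simp add: dist_freq_def diff_divide_distrib)
qed

lemma dist_freq_le_1: "dist_freq \<rho> f x y n t \<le> 1"
proof -
  have "card {i. i < n \<and> \<rho> ((f ^^ i) x) ((f ^^ i) y) < t} \<le> card {..<n}"
    by (rule card_mono) auto
  then show ?thesis
    by (cases "n = 0") (simp_all add: dist_freq_def)
qed

lemma dist_freq_tendsto_1:
  assumes "x \<in> sparse_shift N g" "y \<in> sparse_shift N g" "t > 0"
    and lim: "(\<lambda>n. g n / real n) \<longlonglongrightarrow> 0"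
  shows "(\<lambda>n. dist_freq shift_dist shift_map x y n t) \<longlonglongrightarrow> 1"
proof -
  obtain k :: nat where k: "(1 / 2) ^ k < t"
    using real_arch_pow_inv[OF \<open>t > 0\<close>, of "1 / 2"] by auto
  have "(\<lambda>n. 1 - 2 * real k * (g n / real n)) \<longlonglongrightarrow> 1 - 2 * real k * 0"
    by (intro tendsto_intros lim)
  then have lower: "(\<lambda>n. 1 - 2 * real k * (g n / real n)) \<longlonglongrightarrow> 1"
    by simp
  have "\<forall>\<^sub>F n in sequentially.
      1 - 2 * real k * (g n / real n) \<le> dist_freq shift_dist shift_map x y n t"
    using eventually_gt_at_top[of 0]
    by eventually_elim (intro dist_freq_ge k sparse_shift_weight[OF assms(1)]
        sparse_shift_weight[OF assms(2)])
  then show ?thesis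
    by (rule tendsto_sandwich[OF _ _ lower tendsto_const]) (simp add: dist_freq_le_1)
qed

text \<open>For \<open>t > 0\<close> the frequencies converge to 1, so lower and upper limit agree.
  For \<open>t \<le> 0\<close>, and beyond the diameter, both functions take the same prescribed
  value, so the diameter need not be computed.\<close>

lemma no_DC3_pair_sparse_shift:
  assumes "(\<lambda>n. g n / real n) \<longlonglongrightarrow> 0"
  shows "\<not> DC3_pair (sparse_shift N g) shift_dist shift_map x y"
proof
  let ?Y = "sparse_shift N g"
  assume "DC3_pair ?Y shift_dist shift_map x y"
  then obtain a b where xy: "x \<in> ?Y" "y \<in> ?Y" and "a < b"
    and chaos: "\<And>t. t \<in> {a<..<b} \<Longrightarrow>
      upper_dist ?Y shift_dist shift_map x y t > lower_dist ?Y shift_dist shift_map x y t"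
    unfolding DC3_pair_def by blast
  obtain t where t: "t \<in> {a<..<b}"
    using dense[OF \<open>a < b\<close>] by auto
  have "upper_dist ?Y shift_dist shift_map x y t = lower_dist ?Y shift_dist shift_map x y t"
  proof (cases "t \<le> 0")
    case False
    then have "(\<lambda>n. ereal (dist_freq shift_dist shift_map x y n t)) \<longlonglongrightarrow> 1"
      using dist_freq_tendsto_1[OF xy _ assms] by (simp add: one_ereal_def)
    then show ?thesis
      unfolding upper_dist_def lower_dist_def
      by (simp add: lim_imp_Limsup lim_imp_Liminf)
  qed (simp add: upper_dist_def lower_dist_def)
  then show False
    using chaos[OF t] by simp
qed

section \<open>The sparse shift built from a given subshift\<close>

theorem theorem6p5:
  fixes X :: "(nat \<Rightarrow> nat) set"
  assumes "subshift X"
    and "\<And>x. x \<in> X \<Longrightarrow> has_density {i. i \<ge> 1 \<and> x (i - 1) = 0} 1"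
  shows "\<exists>Y. subshift Y \<and> mixing Y shift_map \<and> X \<subseteq> Y \<and>
           \<not> (\<exists>x y. DC3_pair Y shift_dist shift_map x y)"
proof -
  obtain N where N: "N \<ge> 1" "X \<noteq> {}" "closedin (top_of_set (full_shift N)) X"
    and inv: "shift_map ` X \<subseteq> X"
    using assms(1) unfolding subshift_def by blast
  have "compact X"
    using closedin_compact[OF compact_full_shift N(3)] .
  \<comment> \<open>\<open>max_weight X\<close> may be bounded, for example when \<open>X\<close>
    holds only the zero sequence. The square root forces divergence, as mixing requires, and is
    still sublinear.\<close>
  define g where "g l = real (max_weight X l) + sqrt (real l)" for l
  have nonneg: "g l \<ge> 0" for l
    by (simp add: g_def)
  have "mono g"
    unfolding g_def by (intro monoI add_mono) (auto intro: max_weight_mono[OF N(2)])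
  have "filterlim g at_top sequentially"
    by (rule filterlim_at_top_mono[OF filterlim_compose[OF sqrt_at_top filterlim_real_sequentially]])
      (simp add: g_def)
  have "(\<lambda>n. sqrt (real n) / real n) \<longlonglongrightarrow> 0"
    by real_asymp
  then have "(\<lambda>n. real (max_weight X n) / real n + sqrt (real n) / real n) \<longlonglongrightarrow> 0 + 0"
    by (intro tendsto_add max_weight_sublinear weight_density assms(2) \<open>compact X\<close> N inv)
  then have "(\<lambda>n. g n / real n) \<longlonglongrightarrow> 0"
    by (simp add: g_def add_divide_distrib)
  moreover have "X \<subseteq> sparse_shift N g"
  proof
    fix x assume "x \<in> X"
    have "real (weight x i l) \<le> g l" for i l
    proof -
      have "(shift_map ^^ i) x \<in> X"
        using \<open>x \<in> X\<close> inv by (induction i) auto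
      then have "weight x i l \<le> max_weight X l"
        using weight_le_max_weight[of "(shift_map ^^ i) x" X l] by (simp add: weight_funpow)
      then show ?thesis
        by (simp add: g_def add_increasing2)
    qed
    then show "x \<in> sparse_shift N g"
      using \<open>x \<in> X\<close> closedin_subset[OF N(3)] by (auto simp: sparse_shift_def)
  qed
  ultimately show ?thesis
    using subshift_sparse_shift[OF N(1), of g] nonneg no_DC3_pair_sparse_shift
      mixing_sparse_shift[OF N(1) \<open>mono g\<close> \<open>filterlim g at_top sequentially\<close>] by blast
qed

end
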